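(* Let $m\ge 2$ be an integer and let $(X,\varphi)$ be a minimal topological dynamical system. Then $(X,\varphi)$ is mean $m$-equicontinuous if and only if it is not mean $m$-sensitive.
   Context: A topological dynamical system (tds) $(X,\varphi)$ is a compact metric space $(X,d)$ together with a homeomorphism $\varphi:X\to X$. For $m\ge 2$ and $x_1,\ldots,x_m\in X$ let $$\mathrm{D}_m(x_1,\ldots,x_m)=\min_{1\le i<j\le m} d(x_i,x_j),\qquad \mathrm{D}_m^{\max}(x_1,\ldots,x_m)=\max_{1\le i<j\le m} d(x_i,x_j),$$ $$\overline{\mathrm{D}}_m^{\varphi}(x_1,\ldots,x_m)=\limsup_{n\to\infty}\frac1n\sum_{i=0}^{n-1}\mathrm{D}_m(\varphi^i(x_1),\ldots,\varphi^i(x_m)).$$ $(X,\varphi)$ is mean $m$-equicontinuous if for all $\varepsilon>0$ there is $\delta>0$ such that $\mathrm{D}_m^{\max}(x_1,\ldots,x_m)<\delta$ implies $\overline{\mathrm{D}}_m^{\varphi}(x_1,\ldots,x_m)<\varepsilon$. $(X,\varphi)$ is mean $m$-sensitive if there exists $\varepsilon>0$ such that for every non-empty open set $U\subseteq X$ there exist points $x_1,\ldots,x_m\in U$ with $\overline{\mathrm{D}}_m^{\varphi}(x_1,\ldots,x_m)\ge\varepsilon$. *)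

theory Defs
  imports "HOL-Analysis.Analysis"
begin

text \<open>
  A compact metric space is a compact subset \<open>X\<close> of a type of class \<open>metric_space\<close> with the induced
  metric; the values of \<open>\<phi>\<close> outside \<open>X\<close> are irrelevant. The empty space is excluded: it would be
  both mean equicontinuous and mean sensitive, vacuously.
\<close>

definition tds :: "'a::metric_space set \<Rightarrow> ('a \<Rightarrow> 'a) \<Rightarrow> bool" where
  "tds X \<phi> \<longleftrightarrow> X \<noteq> {} \<and> compact X \<and> (\<exists>\<psi>. homeomorphism X X \<phi> \<psi>)"

definition minimal_tds :: "'a::metric_space set \<Rightarrow> ('a \<Rightarrow> 'a) \<Rightarrow> bool" where
  "minimal_tds X \<phi> \<longleftrightarrow> tds X \<phi> \<and>
     (\<forall>A. A \<subseteq> X \<and> closed A \<and> A \<noteq> {} \<and> \<phi> ` A = A \<longrightarrow> A = X)"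

text \<open>
  An \<open>m\<close>-tuple of points is a function on \<open>nat\<close> of which only the values on \<open>{1..m}\<close> matter.
  \<open>D_min\<close>, \<open>D_max\<close> and \<open>D_bar\<close> are meaningful only for \<open>m \<ge> 2\<close>, when there is some pair
  \<open>i < j\<close>; for \<open>m < 2\<close> they take \<open>Min\<close> and \<open>Max\<close> of the empty set.
\<close>

definition D_min :: "nat \<Rightarrow> (nat \<Rightarrow> 'a::metric_space) \<Rightarrow> real" where
  "D_min m x = Min {dist (x i) (x j) | i j. 1 \<le> i \<and> i < j \<and> j \<le> m}"

definition D_max :: "nat \<Rightarrow> (nat \<Rightarrow> 'a::metric_space) \<Rightarrow> real" where
  "D_max m x = Max {dist (x i) (x j) | i j. 1 \<le> i \<and> i < j \<and> j \<le> m}"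

text \<open>
  The upper limit is taken in \<open>ereal\<close>. On a compact space the averages are bounded, so it is
  a finite number and agrees with the real upper limit.
\<close>

definition D_bar :: "('a::metric_space \<Rightarrow> 'a) \<Rightarrow> nat \<Rightarrow> (nat \<Rightarrow> 'a) \<Rightarrow> ereal" where
  "D_bar \<phi> m x =
     limsup (\<lambda>n. ereal (1 / real n * (\<Sum>k<n. D_min m (\<lambda>i. (\<phi> ^^ k) (x i)))))"

definition mean_equicontinuous :: "nat \<Rightarrow> 'a::metric_space set \<Rightarrow> ('a \<Rightarrow> 'a) \<Rightarrow> bool" where
  "mean_equicontinuous m X \<phi> \<longleftrightarrow>
     (\<forall>\<epsilon>::real. \<epsilon> > 0 \<longrightarrow> (\<exists>\<delta>::real. \<delta> > 0 \<and>
        (\<forall>x. (\<forall>i\<in>{1..m}. x i \<in> X) \<and> D_max m x < \<delta> \<longrightarrow> D_bar \<phi> m x < ereal \<epsilon>)))"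

definition mean_sensitive :: "nat \<Rightarrow> 'a::metric_space set \<Rightarrow> ('a \<Rightarrow> 'a) \<Rightarrow> bool" where
  "mean_sensitive m X \<phi> \<longleftrightarrow>
     (\<exists>\<epsilon>::real. \<epsilon> > 0 \<and>
        (\<forall>U. openin (top_of_set X) U \<and> U \<noteq> {} \<longrightarrow>
           (\<exists>x. (\<forall>i\<in>{1..m}. x i \<in> U) \<and> D_bar \<phi> m x \<ge> ereal \<epsilon>)))"

end

theory Submission
  imports Defs
begin

text \<open>
  Mean \<open>m\<close>-equicontinuity denies mean \<open>m\<close>-sensitivity in any system, because a ball of radius
  \<open>\<delta> / 2\<close> contains only tuples with \<open>D_max < \<delta>\<close>.

  For the converse, fix \<open>\<epsilon> > 0\<close>. Call a relatively open set good if all \<open>m\<close>-tuples in it have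
  \<open>D_bar < \<epsilon>\<close>, and a point tame if it lies in a good set. Failure of mean sensitivity says exactly
  that, for every \<open>\<epsilon>\<close>, tame points exist. The number \<open>D_bar\<close> does not change when the whole tuple
  is moved along by \<open>\<phi>\<close> (lemma \<open>D_bar_shift\<close>), since dropping the first term of a bounded sequence
  does not affect the upper limit of its averages. As \<open>\<phi>\<close> is a homeomorphism, the open set of tame
  points is therefore invariant (lemma \<open>tame_image\<close>), and minimality forces every point to be tame
  (lemma \<open>minimal_open_invariant\<close>). A Lebesgue number of the resulting cover of the compact space
  by good sets is the \<open>\<delta>\<close> required for \<open>\<epsilon>\<close> by mean equicontinuity.
\<close>

section \<open>Averages of tuple distances along orbits\<close>

text \<open>
  The two sums differ only by the term gained and the term lost; being bounded, these become
  negligible after division by \<open>n\<close>.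
\<close>

lemma limsup_average_shift:
  fixes f :: "nat \<Rightarrow> real"
  assumes bound: "\<And>k. \<bar>f k\<bar> \<le> B"
  shows "limsup (\<lambda>n. ereal (1 / real n * (\<Sum>k<n. f (Suc k)))) =
         limsup (\<lambda>n. ereal (1 / real n * (\<Sum>k<n. f k)))"
proof -
  have telescope: "1 / real n * (\<Sum>k<n. f (Suc k)) =
      (f n - f 0) / real n + 1 / real n * (\<Sum>k<n. f k)" for n
  proof -
    have "(\<Sum>k<n. f (Suc k)) = (f n - f 0) + (\<Sum>k<n. f k)"
      by (induction n) auto
    then show ?thesis
      by (simp only: distrib_left) simp
  qed
  have "(\<lambda>n. (f n - f 0) / real n) \<longlonglongrightarrow> 0"
  proof (rule Lim_null_comparison)
    show "\<forall>\<^sub>F n in sequentially. norm ((f n - f 0) / real n) \<le> 2 * B / real n"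
    proof (rule always_eventually, rule allI)
      fix n
      have "\<bar>f n - f 0\<bar> \<le> 2 * B"
        using bound[of n] bound[of 0] by linarith
      then show "norm ((f n - f 0) / real n) \<le> 2 * B / real n"
        by (simp add: divide_right_mono)
    qed
    show "(\<lambda>n. 2 * B / real n) \<longlonglongrightarrow> 0"
      by (rule lim_const_over_n)
  qed
  then have "(\<lambda>n. ereal ((f n - f 0) / real n)) \<longlonglongrightarrow> 0"
    by (simp add: zero_ereal_def)
  from ereal_limsup_lim_add[OF this, of "\<lambda>n. ereal (1 / real n * (\<Sum>k<n. f k))"]
  show ?thesis
    unfolding telescope plus_ereal.simps(1)[symmetric] by simp
qed

lemma finite_pair_distances:
  "finite {dist (x i) (x j) | i j. 1 \<le> i \<and> i < j \<and> j \<le> (m::nat)}"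
proof (rule finite_subset)
  show "{dist (x i) (x j) | i j. 1 \<le> i \<and> i < j \<and> j \<le> m} \<subseteq>
      (\<lambda>(i, j). dist (x i) (x j)) ` ({..m} \<times> {..m})"
    by force
qed simp

lemma D_min_eq_dist:
  assumes "m \<ge> 2"
  obtains i j where "i \<in> {1..m}" "j \<in> {1..m}" "D_min m x = dist (x i) (x j)"
proof -
  have "dist (x 1) (x 2) \<in> {dist (x i) (x j) | i j. 1 \<le> i \<and> i < j \<and> j \<le> m}"
    using assms by force
  then have "D_min m x \<in> {dist (x i) (x j) | i j. 1 \<le> i \<and> i < j \<and> j \<le> m}"
    unfolding D_min_def by (intro Min_in finite_pair_distances) auto
  then obtain i j where "1 \<le> i \<and> i < j \<and> j \<le> m" "D_min m x = dist (x i) (x j)"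
    by blast
  then show ?thesis
    by (intro that[of i j]) auto
qed

lemma D_max_less_iff:
  assumes "m \<ge> 2"
  shows "D_max m x < \<delta> \<longleftrightarrow> (\<forall>i j. 1 \<le> i \<and> i < j \<and> j \<le> m \<longrightarrow> dist (x i) (x j) < \<delta>)"
proof -
  have "dist (x 1) (x 2) \<in> {dist (x i) (x j) | i j. 1 \<le> i \<and> i < j \<and> j \<le> m}"
    using assms by force
  then have "{dist (x i) (x j) | i j. 1 \<le> i \<and> i < j \<and> j \<le> m} \<noteq> {}"
    by blast
  then show ?thesis
    unfolding D_max_def using Max_less_iff[OF finite_pair_distances, of x m \<delta>] by blast
qed

lemma D_bar_cong:
  assumes "\<And>i. i \<in> {1..m} \<Longrightarrow> x i = y i"
  shows "D_bar \<phi> m x = D_bar \<phi> m y"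
proof -
  have "D_min m (\<lambda>i. (\<phi> ^^ k) (x i)) = D_min m (\<lambda>i. (\<phi> ^^ k) (y i))" for k
  proof -
    have "x i = y i \<and> x j = y j" if "1 \<le> i \<and> i < j \<and> j \<le> m" for i j
      using that assms by simp
    then show ?thesis
      unfolding D_min_def by (intro arg_cong[where f = Min] Collect_cong) metis
  qed
  then show ?thesis
    unfolding D_bar_def by simp
qed

lemma D_bar_shift:
  assumes "m \<ge> 2" and "bounded X" and maps: "\<phi> ` X \<subseteq> X"
    and x: "\<And>i. i \<in> {1..m} \<Longrightarrow> x i \<in> X"
  shows "D_bar \<phi> m (\<lambda>i. \<phi> (x i)) = D_bar \<phi> m x"
proof -
  define f where "f k = D_min m (\<lambda>i. (\<phi> ^^ k) (x i))" for k
  have orbit: "(\<phi> ^^ k) (x i) \<in> X" if "i \<in> {1..m}" for k i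
    using that by (induction k) (use maps x in auto)
  have "\<bar>f k\<bar> \<le> diameter X" for k
  proof -
    obtain i j where "i \<in> {1..m}" "j \<in> {1..m}"
      "f k = dist ((\<phi> ^^ k) (x i)) ((\<phi> ^^ k) (x j))"
      unfolding f_def by (rule D_min_eq_dist[OF \<open>m \<ge> 2\<close>])
    then show ?thesis
      using diameter_bounded_bound[OF \<open>bounded X\<close>] orbit by simp
  qed
  then have "limsup (\<lambda>n. ereal (1 / real n * (\<Sum>k<n. f (Suc k)))) =
      limsup (\<lambda>n. ereal (1 / real n * (\<Sum>k<n. f k)))"
    by (rule limsup_average_shift)
  then show ?thesis
    unfolding D_bar_def f_def by (simp add: funpow_swap1)
qed

section \<open>Minimality and tame points\<close>

lemma minimal_open_invariant:
  assumes min: "minimal_tds X \<phi>"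
    and G: "openin (top_of_set X) G" "G \<noteq> {}" "\<phi> ` G = G"
  shows "G = X"
proof -
  obtain \<psi> where hom: "homeomorphism X X \<phi> \<psi>" and "compact X"
    using min unfolding minimal_tds_def tds_def by blast
  have sub: "G \<subseteq> X"
    using G(1) by (rule openin_imp_subset)
  have "closedin (top_of_set X) (X - G)"
    using G(1) by (simp add: closedin_diff)
  then have "closed (X - G)"
    using \<open>compact X\<close> closedin_closed_trans compact_imp_closed by blast
  moreover have "\<phi> ` (X - G) = X - G"
  proof -
    have "inj_on \<phi> X"
      using hom by (metis homeomorphism_def inj_on_inverseI)
    then have "\<phi> ` (X - G) = \<phi> ` X - \<phi> ` G"
      using sub by (simp add: inj_on_image_set_diff)
    then show ?thesis
      using G(3) hom by (simp add: homeomorphism_image1)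
  qed
  ultimately have "X - G = {} \<or> X - G = X"
    using min unfolding minimal_tds_def by blast
  then show ?thesis
    using sub G(2) by blast
qed

definition tame_points :: "real \<Rightarrow> nat \<Rightarrow> 'a::metric_space set \<Rightarrow> ('a \<Rightarrow> 'a) \<Rightarrow> 'a set" where
  "tame_points \<epsilon> m X \<phi> = \<Union> {W. openin (top_of_set X) W \<and>
     (\<forall>x. (\<forall>i\<in>{1..m}. x i \<in> W) \<longrightarrow> D_bar \<phi> m x < ereal \<epsilon>)}"

text \<open>
  The image and the preimage of a good set \<open>W\<close> are again good: a tuple in \<open>\<phi> ` W\<close> is the
  image of a tuple in \<open>W\<close>, a tuple in the preimage of \<open>W\<close> has its image in \<open>W\<close>, and \<open>D_bar\<close> agrees for a tuple and its image.
\<close>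

lemma tame_image:
  assumes "m \<ge> 2" and "bounded X" and hom: "homeomorphism X X \<phi> \<psi>"
  shows "\<phi> ` tame_points \<epsilon> m X \<phi> = tame_points \<epsilon> m X \<phi>"
proof (rule equalityI; rule subsetI)
  let ?good = "\<lambda>W. openin (top_of_set X) W \<and>
      (\<forall>x. (\<forall>i\<in>{1..m}. x i \<in> W) \<longrightarrow> D_bar \<phi> m x < ereal \<epsilon>)"
  have maps: "\<phi> ` X \<subseteq> X" and inv_maps: "\<And>y. y \<in> X \<Longrightarrow> \<psi> y \<in> X"
    using hom by (auto simp: homeomorphism_def)
  have inv: "\<phi> (\<psi> y) = y" "\<psi> (\<phi> y) = y" if "y \<in> X" for y
    using hom that by (auto simp: homeomorphism_def)
  note shift = D_bar_shift[OF \<open>m \<ge> 2\<close> \<open>bounded X\<close> maps]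
  {
    fix y
    assume "y \<in> \<phi> ` tame_points \<epsilon> m X \<phi>"
    then obtain w W where y: "y = \<phi> w" "w \<in> W" and W: "?good W"
      unfolding tame_points_def by blast
    have sub: "W \<subseteq> X"
      using W openin_imp_subset by blast
    have "D_bar \<phi> m x < ereal \<epsilon>" if x: "\<forall>i\<in>{1..m}. x i \<in> \<phi> ` W" for x
    proof -
      have pre: "\<psi> (x i) \<in> W" "\<phi> (\<psi> (x i)) = x i" if i: "i \<in> {1..m}" for i
      proof -
        obtain v where "v \<in> W" "x i = \<phi> v"
          using x i by blast
        then show "\<psi> (x i) \<in> W" "\<phi> (\<psi> (x i)) = x i"
          using sub inv by auto
      qed
      have "D_bar \<phi> m x = D_bar \<phi> m (\<lambda>i. \<phi> (\<psi> (x i)))"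
        by (rule D_bar_cong) (simp add: pre)
      also have "\<dots> = D_bar \<phi> m (\<lambda>i. \<psi> (x i))"
        by (rule shift) (use pre sub in blast)
      also have "\<dots> < ereal \<epsilon>"
        by (rule W[THEN conjunct2, rule_format]) (rule pre)
      finally show ?thesis .
    qed
    moreover have "openin (top_of_set X) (\<phi> ` W)"
      using W homeomorphism_imp_open_map[OF hom] by blast
    ultimately show "y \<in> tame_points \<epsilon> m X \<phi>"
      unfolding tame_points_def using y by blast
  }
  {
    fix y
    assume "y \<in> tame_points \<epsilon> m X \<phi>"
    then obtain W where y: "y \<in> W" and W: "?good W"
      unfolding tame_points_def by blast
    have sub: "W \<subseteq> X"
      using W openin_imp_subset by blast
    have "D_bar \<phi> m x < ereal \<epsilon>" if x: "\<forall>i\<in>{1..m}. x i \<in> \<psi> ` W" for x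
    proof -
      have img: "x i \<in> X" "\<phi> (x i) \<in> W" if i: "i \<in> {1..m}" for i
      proof -
        obtain v where "v \<in> W" "x i = \<psi> v"
          using x i by blast
        then show "x i \<in> X" "\<phi> (x i) \<in> W"
          using sub inv inv_maps by auto
      qed
      have "D_bar \<phi> m x = D_bar \<phi> m (\<lambda>i. \<phi> (x i))"
        by (rule shift[symmetric]) (rule img)
      also have "\<dots> < ereal \<epsilon>"
        by (rule W[THEN conjunct2, rule_format]) (rule img)
      finally show ?thesis .
    qed
    moreover have "openin (top_of_set X) (\<psi> ` W)"
      using W homeomorphism_imp_open_map homeomorphism_symD[OF hom] by blast
    ultimately have "\<psi> y \<in> tame_points \<epsilon> m X \<phi>"
      unfolding tame_points_def using y by blast
    then show "y \<in> \<phi> ` tame_points \<epsilon> m X \<phi>"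
      using inv(1)[of y] y sub by (metis imageI subsetD)
  }
qed

section \<open>Mean equicontinuity against mean sensitivity\<close>

lemma mean_equicontinuous_imp_not_mean_sensitive:
  assumes "m \<ge> 2" and "X \<noteq> {}" and equi: "mean_equicontinuous m X \<phi>"
  shows "\<not> mean_sensitive m X \<phi>"
proof
  assume "mean_sensitive m X \<phi>"
  then obtain \<epsilon> :: real where "\<epsilon> > 0" and
    sens: "\<And>U. openin (top_of_set X) U \<Longrightarrow> U \<noteq> {} \<Longrightarrow>
      \<exists>x. (\<forall>i\<in>{1..m}. x i \<in> U) \<and> D_bar \<phi> m x \<ge> ereal \<epsilon>"
    unfolding mean_sensitive_def by metis
  obtain \<delta> :: real where "\<delta> > 0" and
    \<delta>: "\<And>x. \<lbrakk>\<forall>i\<in>{1..m}. x i \<in> X; D_max m x < \<delta>\<rbrakk> \<Longrightarrow> D_bar \<phi> m x < ereal \<epsilon>"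
    using equi \<open>\<epsilon> > 0\<close> unfolding mean_equicontinuous_def by metis
  obtain a where "a \<in> X"
    using \<open>X \<noteq> {}\<close> by blast
  have "openin (top_of_set X) (X \<inter> ball a (\<delta> / 2))" "X \<inter> ball a (\<delta> / 2) \<noteq> {}"
    using \<open>a \<in> X\<close> \<open>\<delta> > 0\<close> by (auto simp: openin_open_Int)
  then obtain x where x: "\<forall>i\<in>{1..m}. x i \<in> X \<inter> ball a (\<delta> / 2)" and "D_bar \<phi> m x \<ge> ereal \<epsilon>"
    using sens by blast
  moreover have "D_max m x < \<delta>"
    unfolding D_max_less_iff[OF \<open>m \<ge> 2\<close>]
  proof (intro allI impI)
    fix i j
    assume "1 \<le> i \<and> i < j \<and> j \<le> m"
    then have "dist a (x i) < \<delta> / 2" "dist a (x j) < \<delta> / 2"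
      using x by auto
    then show "dist (x i) (x j) < \<delta>"
      by (rule dist_triangle_half_r)
  qed
  ultimately show False
    using \<delta>[of x] by (auto simp: not_less[symmetric])
qed

text \<open>
  A Lebesgue number \<open>\<delta>\<close> works because a tuple with \<open>D_max < \<delta>\<close> lies in the ball of radius \<open>\<delta>\<close>
  around its first entry, hence inside a single good set.
\<close>

lemma mean_equicontinuous_if_all_tame:
  assumes "m \<ge> 2" and "compact X"
    and tame: "\<And>\<epsilon>. \<epsilon> > 0 \<Longrightarrow> tame_points \<epsilon> m X \<phi> = X"
  shows "mean_equicontinuous m X \<phi>"
  unfolding mean_equicontinuous_def
proof (intro allI impI)
  fix \<epsilon> :: real
  assume "\<epsilon> > 0"
  define \<T> where "\<T> = {T. open T \<and>
      (\<forall>x. (\<forall>i\<in>{1..m}. x i \<in> X \<inter> T) \<longrightarrow> D_bar \<phi> m x < ereal \<epsilon>)}"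
  have cover: "X \<subseteq> \<Union> \<T>"
  proof
    fix a
    assume "a \<in> X"
    then have "a \<in> tame_points \<epsilon> m X \<phi>"
      using tame[OF \<open>\<epsilon> > 0\<close>] by simp
    then obtain W where "a \<in> W" "openin (top_of_set X) W"
      and W: "\<forall>x. (\<forall>i\<in>{1..m}. x i \<in> W) \<longrightarrow> D_bar \<phi> m x < ereal \<epsilon>"
      unfolding tame_points_def by blast
    moreover obtain T where "open T" "W = X \<inter> T"
      using \<open>openin (top_of_set X) W\<close> by (auto simp: openin_open)
    ultimately show "a \<in> \<Union> \<T>"
      unfolding \<T>_def by blast
  qed
  obtain \<delta> where "\<delta> > 0" and \<delta>: "\<And>a. a \<in> X \<Longrightarrow> \<exists>T\<in>\<T>. ball a \<delta> \<subseteq> T"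
    using Heine_Borel_lemma[OF \<open>compact X\<close> cover] unfolding \<T>_def by blast
  show "\<exists>\<delta>>0. \<forall>x. (\<forall>i\<in>{1..m}. x i \<in> X) \<and> D_max m x < \<delta> \<longrightarrow> D_bar \<phi> m x < ereal \<epsilon>"
  proof (intro exI[of _ \<delta>] conjI allI impI)
    fix x
    assume x: "(\<forall>i\<in>{1..m}. x i \<in> X) \<and> D_max m x < \<delta>"
    then obtain T where "T \<in> \<T>" "ball (x 1) \<delta> \<subseteq> T"
      using \<delta>[of "x 1"] \<open>m \<ge> 2\<close> by auto
    moreover have "x i \<in> ball (x 1) \<delta>" if "i \<in> {1..m}" for i
      using x that \<open>\<delta> > 0\<close> unfolding D_max_less_iff[OF \<open>m \<ge> 2\<close>]
      by (cases "i = 1") auto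
    ultimately show "D_bar \<phi> m x < ereal \<epsilon>"
      using x unfolding \<T>_def by blast
  qed (rule \<open>\<delta> > 0\<close>)
qed

theorem theorem1p3:
  fixes X :: "'a::metric_space set" and \<phi> :: "'a \<Rightarrow> 'a" and m :: nat
  assumes "m \<ge> 2"
    and "minimal_tds X \<phi>"
  shows "mean_equicontinuous m X \<phi> \<longleftrightarrow> \<not> mean_sensitive m X \<phi>"
proof
  obtain \<psi> where hom: "homeomorphism X X \<phi> \<psi>" and "compact X" "X \<noteq> {}"
    using assms(2) unfolding minimal_tds_def tds_def by blast
  {
    assume "mean_equicontinuous m X \<phi>"
    then show "\<not> mean_sensitive m X \<phi>"
      by (rule mean_equicontinuous_imp_not_mean_sensitive[OF assms(1) \<open>X \<noteq> {}\<close>])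
  }
  assume not_sensitive: "\<not> mean_sensitive m X \<phi>"
  show "mean_equicontinuous m X \<phi>"
  proof (rule mean_equicontinuous_if_all_tame[OF assms(1) \<open>compact X\<close>])
    fix \<epsilon> :: real
    assume "\<epsilon> > 0"
    show "tame_points \<epsilon> m X \<phi> = X"
    proof (rule minimal_open_invariant[OF assms(2)])
      show "openin (top_of_set X) (tame_points \<epsilon> m X \<phi>)"
        unfolding tame_points_def by (rule openin_Union) blast
      show "\<phi> ` tame_points \<epsilon> m X \<phi> = tame_points \<epsilon> m X \<phi>"
        using tame_image[OF assms(1) compact_imp_bounded[OF \<open>compact X\<close>] hom] .
      obtain U where "openin (top_of_set X) U" "U \<noteq> {}"
        "\<not> (\<exists>x. (\<forall>i\<in>{1..m}. x i \<in> U) \<and> D_bar \<phi> m x \<ge> ereal \<epsilon>)"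
        using not_sensitive \<open>\<epsilon> > 0\<close> unfolding mean_sensitive_def by blast
      then show "tame_points \<epsilon> m X \<phi> \<noteq> {}"
        unfolding tame_points_def not_le[symmetric] by blast
    qed
  qed
qed

end
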